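(* Let $A\in\mathbb{R}^{n\times n}$, $B\in\mathbb{R}^{n\times m}$, $C\in\mathbb{R}^{m\times n}$, $D\in\mathbb{R}^{m\times m}$, $E_1\in\mathbb{R}^{n\times l}$, $E_2\in\mathbb{R}^{m\times l}$, with $D$ a $P$-matrix and $A$ nonsingular. Let $r,s\in\mathbb{R}^l$ and $$F(\xi,r,s) = A\xi + B\left[-f_D^{-1}(C\xi+E_2 s)\right]^+ + E_1 r .$$ Define $$M = D - CA^{-1}B, \qquad \bar q(r,s) = E_2 s - CA^{-1}E_1 r .$$ If $\xi^\ast\in\mathbb{R}^n$ is an equilibrium of $\dot\xi = F(\xi,r,s)$ (that is, $F(\xi^\ast,r,s)=0$), then $x^\ast = X(\xi^\ast,s)$, with $$X(\xi,s) = f_D^{-1}(C\xi+E_2 s),$$ is a solution of $f_M(x^\ast)=\bar q(r,s)$. Conversely, if $x^\ast\in\mathbb{R}^m$ is a solution of $f_M(x^\ast)=\bar q(r,s)$, then $\xi^\ast = \Xi(x^\ast,r)$, with $$\Xi(x,r) = -A^{-1}\left(B[-x]^+ + E_1 r\right),$$ is an equilibrium of $\dot\xi = F(\xi,r,s)$.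
   Context: For $x\in\mathbb{R}^m$, $[x]^+$ is the Euclidean projection of $x$ onto the nonnegative orthant $\mathbb{R}^m_+$ (componentwise $\max(x_i,0)$). For a matrix $N\in\mathbb{R}^{m\times m}$, $f_N:\mathbb{R}^m\to\mathbb{R}^m$ is the piecewise linear map defined by $f_N(x) = C_{-N}(\alpha)x$ for $x\in\operatorname{pos} C_I(\alpha)$, $\alpha\subseteq\{1,\dots,m\}$, where $C_N(\alpha)$ is the matrix whose $j$-th column is $-N_{\cdot,j}$ if $j\in\alpha$ and the identity column $I_{\cdot,j}$ if $j\notin\alpha$, and $\operatorname{pos}$ denotes the cone of nonnegative linear combinations of the columns (so the cones $\operatorname{pos} C_I(\alpha)$ are the closed orthants); equivalently $f_N(x) = [x]^+ - N[-x]^+$. A $P$-matrix is a square matrix all of whose principal minors are positive; when $D$ is a $P$-matrix, $f_D$ is a bijection of $\mathbb{R}^m$ and $f_D^{-1}$ denotes its inverse. The system $\dot\xi=F(\xi,r,s)$ is the explicit form of the linear complementarity system $\dot\xi = A\xi+Bz+E_1r$, $w = C\xi+Dz+E_2s$, $\mathbb{R}^m_+\ni w\perp z\in\mathbb{R}^m_+$. *)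

theory Defs
  imports "HOL-Analysis.Analysis"
begin

definition nonneg_orthant :: "(real ^ 'm) set" where
  "nonneg_orthant = {x. \<forall>i. 0 \<le> x $ i}"

definition proj_orthant :: "real ^ 'm \<Rightarrow> real ^ 'm" where
  "proj_orthant x = closest_point nonneg_orthant x"

lemma proj_orthant_nth: "proj_orthant x $ i = max (x $ i) 0"
proof -
  let ?p = "\<chi> i. max (x $ i) 0"
  have p: "?p \<in> nonneg_orthant" by (simp add: nonneg_orthant_def)
  have le: "dist x ?p \<le> dist x y" if "y \<in> nonneg_orthant" for y
    unfolding dist_vec_def
  proof (rule L2_set_mono)
    fix i
    have "0 \<le> y $ i" using that by (simp add: nonneg_orthant_def)
    then show "dist (x $ i) (?p $ i) \<le> dist (x $ i) (y $ i)"
      by (auto simp: dist_real_def max_def)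
  qed simp
  have "closed (nonneg_orthant :: (real ^ 'b) set)"
    unfolding nonneg_orthant_def
    by (intro closed_Collect_all closed_Collect_le continuous_intros)
  moreover have "convex (nonneg_orthant :: (real ^ 'b) set)"
    by (auto simp: nonneg_orthant_def convex_def)
  ultimately have "?p = closest_point nonneg_orthant x"
    using p le by (intro closest_point_unique) auto
  then show ?thesis
    unfolding proj_orthant_def by (metis vec_lambda_beta)
qed

definition compl_matrix :: "real ^ 'm ^ 'm \<Rightarrow> 'm set \<Rightarrow> real ^ 'm ^ 'm" where
  "compl_matrix N \<alpha> = (\<chi> i j. if j \<in> \<alpha> then - (N $ i $ j) else mat 1 $ i $ j)"

definition pos_cone :: "real ^ 'k ^ 'm \<Rightarrow> (real ^ 'm) set" where
  "pos_cone G = {G *v v | v. v \<in> nonneg_orthant}"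

text \<open>The closed orthants overlap on their boundaries, so the piecewise definition needs the
  pieces to agree there; this is \<open>pl_map_piece\<close> below.\<close>

definition pl_map :: "real ^ 'm ^ 'm \<Rightarrow> real ^ 'm \<Rightarrow> real ^ 'm" where
  "pl_map N x = (THE y. \<exists>\<alpha>. x \<in> pos_cone (compl_matrix (mat 1) \<alpha>) \<and>
                             y = compl_matrix (- N) \<alpha> *v x)"

lemma compl_matrix_1_mult_nth:
  "(compl_matrix (mat 1) \<alpha> *v v) $ i = (if i \<in> \<alpha> then - (v $ i) else v $ i)"
proof -
  have "(compl_matrix (mat 1) \<alpha> *v v) $ i =
      (\<Sum>j\<in>UNIV. if i = j then (if i \<in> \<alpha> then - (v $ i) else v $ i) else 0)"
    unfolding matrix_vector_mult_def compl_matrix_def vec_lambda_beta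
    by (rule sum.cong[OF refl]) (auto simp: mat_def)
  then show ?thesis by simp
qed

lemma pos_cone_compl_matrix_1:
  "x \<in> pos_cone (compl_matrix (mat 1) \<alpha>) \<longleftrightarrow>
     (\<forall>i. (i \<in> \<alpha> \<longrightarrow> x $ i \<le> 0) \<and> (i \<notin> \<alpha> \<longrightarrow> 0 \<le> x $ i))"
proof
  assume "x \<in> pos_cone (compl_matrix (mat 1) \<alpha>)"
  then show "\<forall>i. (i \<in> \<alpha> \<longrightarrow> x $ i \<le> 0) \<and> (i \<notin> \<alpha> \<longrightarrow> 0 \<le> x $ i)"
    by (auto simp: pos_cone_def nonneg_orthant_def compl_matrix_1_mult_nth)
next
  assume *: "\<forall>i. (i \<in> \<alpha> \<longrightarrow> x $ i \<le> 0) \<and> (i \<notin> \<alpha> \<longrightarrow> 0 \<le> x $ i)"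
  let ?v = "\<chi> i. if i \<in> \<alpha> then - (x $ i) else x $ i"
  have "x = compl_matrix (mat 1) \<alpha> *v ?v"
    by (simp add: vec_eq_iff compl_matrix_1_mult_nth)
  moreover have "?v \<in> nonneg_orthant" using * by (simp add: nonneg_orthant_def)
  ultimately show "x \<in> pos_cone (compl_matrix (mat 1) \<alpha>)"
    unfolding pos_cone_def by blast
qed

lemma compl_matrix_mult_on_cone:
  assumes "x \<in> pos_cone (compl_matrix (mat 1) \<alpha>)"
  shows "compl_matrix (- N) \<alpha> *v x = proj_orthant x - N *v proj_orthant (- x)"
proof -
  have s: "(i \<in> \<alpha> \<longrightarrow> x $ i \<le> 0) \<and> (i \<notin> \<alpha> \<longrightarrow> 0 \<le> x $ i)" for i
    using assms by (simp add: pos_cone_compl_matrix_1)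
  have "(compl_matrix (- N) \<alpha> *v x) $ i = (proj_orthant x - N *v proj_orthant (- x)) $ i" for i
  proof -
    have "(compl_matrix (- N) \<alpha> *v x) $ i =
        (\<Sum>j\<in>UNIV. (if i = j then max (x $ i) 0 else 0) - N $ i $ j * max (- (x $ j)) 0)"
      unfolding matrix_vector_mult_def compl_matrix_def vec_lambda_beta
    proof (rule sum.cong[OF refl])
      fix j
      show "(if j \<in> \<alpha> then - ((- N) $ i $ j) else mat 1 $ i $ j) * x $ j =
        (if i = j then max (x $ i) 0 else 0) - N $ i $ j * max (- (x $ j)) 0"
        using s[of j] by (auto simp: mat_def max_def)
    qed
    then show ?thesis
      by (simp add: sum_subtractf matrix_vector_mult_def proj_orthant_nth)
  qed
  then show ?thesis by (simp add: vec_eq_iff)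
qed

lemma pl_map_eq: "pl_map N x = proj_orthant x - N *v proj_orthant (- x)"
proof -
  have "x \<in> pos_cone (compl_matrix (mat 1) {i. x $ i < 0})"
    by (auto simp: pos_cone_compl_matrix_1)
  then show ?thesis
    unfolding pl_map_def
    by (intro the_equality) (auto simp: compl_matrix_mult_on_cone)
qed

lemma pl_map_piece:
  assumes "x \<in> pos_cone (compl_matrix (mat 1) \<alpha>)"
  shows "pl_map N x = compl_matrix (- N) \<alpha> *v x"
  using assms by (simp add: pl_map_eq compl_matrix_mult_on_cone)

text \<open>Principal minors are given by the Leibniz formula over the index set \<open>\<alpha>\<close>, since the
  principal submatrices have no common index type.\<close>

definition principal_minor :: "real ^ 'm ^ 'm \<Rightarrow> 'm set \<Rightarrow> real" where
  "principal_minor N \<alpha> =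
     (\<Sum>p | p permutes \<alpha>. of_int (sign p) * (\<Prod>i\<in>\<alpha>. N $ i $ p i))"

lemma principal_minor_UNIV: "principal_minor N UNIV = det N"
  by (simp add: principal_minor_def det_def)

definition P_matrix :: "real ^ 'm ^ 'm \<Rightarrow> bool" where
  "P_matrix N \<longleftrightarrow> (\<forall>\<alpha>. \<alpha> \<noteq> {} \<longrightarrow> 0 < principal_minor N \<alpha>)"

definition lcs_X ::
  "real ^ 'n ^ 'm \<Rightarrow> real ^ 'm ^ 'm \<Rightarrow> real ^ 'l ^ 'm \<Rightarrow> real ^ 'n \<Rightarrow> real ^ 'l \<Rightarrow> real ^ 'm" where
  "lcs_X C D E2 \<xi> s = inv (pl_map D) (C *v \<xi> + E2 *v s)"

definition lcs_F ::
  "real ^ 'n ^ 'n \<Rightarrow> real ^ 'm ^ 'n \<Rightarrow> real ^ 'n ^ 'm \<Rightarrow> real ^ 'm ^ 'm \<Rightarrow>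
   real ^ 'l ^ 'n \<Rightarrow> real ^ 'l ^ 'm \<Rightarrow> real ^ 'n \<Rightarrow> real ^ 'l \<Rightarrow> real ^ 'l \<Rightarrow> real ^ 'n" where
  "lcs_F A B C D E1 E2 \<xi> r s =
     A *v \<xi> + B *v proj_orthant (- inv (pl_map D) (C *v \<xi> + E2 *v s)) + E1 *v r"

definition lcs_M ::
  "real ^ 'n ^ 'n \<Rightarrow> real ^ 'm ^ 'n \<Rightarrow> real ^ 'n ^ 'm \<Rightarrow> real ^ 'm ^ 'm \<Rightarrow> real ^ 'm ^ 'm" where
  "lcs_M A B C D = D - C ** matrix_inv A ** B"

definition lcs_qbar ::
  "real ^ 'n ^ 'n \<Rightarrow> real ^ 'n ^ 'm \<Rightarrow> real ^ 'l ^ 'n \<Rightarrow> real ^ 'l ^ 'm \<Rightarrow>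
   real ^ 'l \<Rightarrow> real ^ 'l \<Rightarrow> real ^ 'm" where
  "lcs_qbar A C E1 E2 r s = E2 *v s - (C ** matrix_inv A ** E1) *v r"

definition lcs_Xi ::
  "real ^ 'n ^ 'n \<Rightarrow> real ^ 'm ^ 'n \<Rightarrow> real ^ 'l ^ 'n \<Rightarrow> real ^ 'm \<Rightarrow> real ^ 'l \<Rightarrow> real ^ 'n" where
  "lcs_Xi A B E1 x r = - (matrix_inv A *v (B *v proj_orthant (- x) + E1 *v r))"

end

theory Submission
  imports Defs
begin

text \<open>The substance is that \<open>f\<^sub>D\<close> is a bijection when \<open>D\<close> is a P-matrix. A P-matrix reverses the
  sign of no nonzero vector: otherwise \<open>D + \<Lambda>\<close>, restricted to the support of that vector, would be
  singular for some nonnegative diagonal \<open>\<Lambda>\<close>, although adding \<open>\<Lambda>\<close> keeps all principal minors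
  positive. Hence \<open>f\<^sub>D\<close> is injective. By positive homogeneity it is then norm-coercive, so its range
  is closed, and by invariance of domain its range is open. Given bijectivity, equilibria and
  solutions of \<open>f\<^sub>M x = q\<close> correspond by solving \<open>F(\<xi>,r,s) = 0\<close> for the linear term \<open>A\<xi>\<close>.\<close>

section \<open>Principal minors and sign reversal for P-matrices\<close>

lemma principal_minor_empty [simp]: "principal_minor N {} = 1"
  by (simp add: principal_minor_def)

text \<open>A minor is affine in each diagonal entry. The permutations of \<open>\<alpha>\<close>
  that fix \<open>i\<close> are exactly those of \<open>\<alpha> - {i}\<close>, and
  \<open>sign p\<close> does not depend on the index set, so the coefficient of \<open>t\<close> is
  again a Leibniz sum.\<close>

lemma principal_minor_add_diagonal_entry:
  fixes N :: "real ^ 'm ^ 'm"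
  shows "principal_minor (\<chi> a b. N $ a $ b + (if a = i \<and> b = i then t else 0)) \<alpha> =
    principal_minor N \<alpha> + (if i \<in> \<alpha> then t * principal_minor N (\<alpha> - {i}) else 0)"
proof (cases "i \<in> \<alpha>")
  case False
  then have "(\<Prod>a\<in>\<alpha>. N $ a $ p a + (if a = i \<and> p a = i then t else 0)) = (\<Prod>a\<in>\<alpha>. N $ a $ p a)" for p
    by (intro prod.cong) auto
  with False show ?thesis by (simp add: principal_minor_def)
next
  case True
  let ?\<beta> = "\<alpha> - {i}"
  have prod: "(\<Prod>a\<in>\<alpha>. N $ a $ p a + (if a = i \<and> p a = i then t else 0)) =
      (\<Prod>a\<in>\<alpha>. N $ a $ p a) + (if p i = i then t * (\<Prod>a\<in>?\<beta>. N $ a $ p a) else 0)" for p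
  proof -
    have "(\<Prod>a\<in>?\<beta>. N $ a $ p a + (if a = i \<and> p a = i then t else 0)) = (\<Prod>a\<in>?\<beta>. N $ a $ p a)"
      by (intro prod.cong) auto
    then show ?thesis
      by (simp add: prod.remove[OF _ True] distrib_right)
  qed
  have perm: "{p. p permutes ?\<beta>} = {p. p permutes \<alpha>} \<inter> {p. p i = i}"
    using permutes_superset[of _ \<alpha> ?\<beta>] permutes_subset[of _ ?\<beta> \<alpha>]
    by (auto simp: permutes_not_in)
  have "(\<Sum>p | p permutes \<alpha>. of_int (sign p) * (if p i = i then t * (\<Prod>a\<in>?\<beta>. N $ a $ p a) else 0)) =
      (\<Sum>p | p permutes \<alpha>. if p \<in> {p. p i = i} then t * (of_int (sign p) * (\<Prod>a\<in>?\<beta>. N $ a $ p a)) else 0)"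
    by (intro sum.cong) auto
  also have "\<dots> = (\<Sum>p | p permutes ?\<beta>. t * (of_int (sign p) * (\<Prod>a\<in>?\<beta>. N $ a $ p a)))"
    unfolding perm by (rule sum.inter_restrict[symmetric]) (simp add: finite_permutations)
  finally show ?thesis
    using True by (simp add: principal_minor_def prod distrib_left sum.distrib sum_distrib_left)
qed

text \<open>The diagonal entries are added one at a time: each addition changes a minor by
  \<open>l i\<close> times a minor of the previous matrix, which is a nonnegative amount.\<close>

lemma P_matrix_add_diagonal:
  fixes N :: "real ^ 'm ^ 'm"
  assumes "P_matrix N" and nonneg: "\<And>i. 0 \<le> l i"
  shows "P_matrix (\<chi> a b. N $ a $ b + (if a = b then l a else 0))"
proof -
  have "P_matrix (\<chi> a b. N $ a $ b + (if a = b \<and> a \<in> S then l a else 0))" for S :: "'m set"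
  proof (induction S rule: finite_induct[OF finite])
    case 1
    show ?case using \<open>P_matrix N\<close> by simp
  next
    case (2 i S)
    let ?N = "\<chi> a b. N $ a $ b + (if a = b \<and> a \<in> S then l a else 0)"
    have eq: "(\<chi> a b. N $ a $ b + (if a = b \<and> a \<in> insert i S then l a else 0)) =
        (\<chi> a b. ?N $ a $ b + (if a = i \<and> b = i then l i else 0))"
      using \<open>i \<notin> S\<close> by (auto simp: vec_eq_iff)
    have pos: "0 < principal_minor ?N \<beta>" if "\<beta> \<noteq> {}" for \<beta>
      using "2.IH"[unfolded P_matrix_def, rule_format, OF that] .
    \<comment> \<open>For \<open>\<alpha> = {i}\<close> the minor is the empty one, about which
      \<open>P_matrix\<close> says nothing; its value is 1.\<close>
    have "0 \<le> principal_minor ?N (\<alpha> - {i})" for \<alpha>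
    proof (cases "\<alpha> - {i} = {}")
      case True
      show ?thesis unfolding True by simp
    next
      case False
      then show ?thesis by (intro less_imp_le pos)
    qed
    then have "0 \<le> (if i \<in> \<alpha> then l i * principal_minor ?N (\<alpha> - {i}) else 0)" for \<alpha>
      using nonneg[of i] by simp
    then show ?case
      unfolding eq P_matrix_def principal_minor_add_diagonal_entry
      by (intro allI impI add_pos_nonneg pos)
  qed
  from this[of UNIV] show ?thesis by simp
qed

text \<open>This expresses a minor as a determinant of full size, so that nonvanishing can be turned
  into injectivity. A permutation that moves some index outside \<open>\<alpha>\<close> picks an
  off-diagonal zero from an identity row.\<close>

lemma det_identity_rows:
  "det (\<chi> a b. if a \<in> \<alpha> then N $ a $ b else mat 1 $ a $ b) = principal_minor N \<alpha>"
proof -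
  let ?K = "\<chi> a b. if a \<in> \<alpha> then N $ a $ b else mat 1 $ a $ b"
  have "det ?K = (\<Sum>p | p permutes \<alpha>. of_int (sign p) * (\<Prod>a\<in>UNIV. ?K $ a $ p a))"
    unfolding det_def
  proof (rule sum.mono_neutral_right)
    show "\<forall>p \<in> {p. p permutes UNIV} - {p. p permutes \<alpha>}.
        of_int (sign p) * (\<Prod>a\<in>UNIV. ?K $ a $ p a) = 0"
    proof
      fix p assume "p \<in> {p. p permutes UNIV} - {p. p permutes \<alpha>}"
      then obtain a where "a \<notin> \<alpha>" "p a \<noteq> a"
        using permutes_superset[of p UNIV \<alpha>] by auto
      then have "?K $ a $ p a = 0" by (simp add: mat_def)
      then have "(\<Prod>a\<in>UNIV. ?K $ a $ p a) = 0"
        by (intro prod_zero bexI[of _ a]) auto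
      then show "of_int (sign p) * (\<Prod>a\<in>UNIV. ?K $ a $ p a) = 0" by simp
    qed
  qed (auto simp: finite_permutations intro: permutes_subset)
  also have "\<dots> = principal_minor N \<alpha>"
    unfolding principal_minor_def
  proof (intro sum.cong refl)
    fix p assume "p \<in> {p. p permutes \<alpha>}"
    then have "(\<Prod>a\<in>UNIV. ?K $ a $ p a) = (\<Prod>a\<in>\<alpha>. ?K $ a $ p a)"
      by (intro prod.mono_neutral_right) (auto simp: permutes_not_in mat_def)
    then show "of_int (sign p) * (\<Prod>a\<in>UNIV. ?K $ a $ p a) =
        of_int (sign p) * (\<Prod>a\<in>\<alpha>. N $ a $ p a)"
      by simp
  qed
  finally show ?thesis .
qed

lemma P_matrix_sign_reversal:
  fixes N :: "real ^ 'm ^ 'm"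
  assumes "P_matrix N" and rev: "\<And>i. u $ i * (N *v u) $ i \<le> 0"
  shows "u = 0"
proof (rule ccontr)
  assume "u \<noteq> 0"
  define \<alpha> where "\<alpha> = {i. u $ i \<noteq> 0}"
  \<comment> \<open>Chosen so that the added diagonal cancels \<open>N *v u\<close> on the support
    of \<open>u\<close>. The hypothesis \<open>rev\<close> makes it nonnegative there; off the
    support, division by zero gives 0.\<close>
  define l where "l i = - (N *v u) $ i / u $ i" for i
  define L where "L = (\<chi> a b. N $ a $ b + (if a = b then l a else 0))"
  let ?K = "\<chi> a b. if a \<in> \<alpha> then L $ a $ b else mat 1 $ a $ b"
  have "0 \<le> l i" for i
    using rev[of i] by (auto simp: l_def divide_le_0_iff mult_le_0_iff)
  then have "P_matrix L"
    unfolding L_def using \<open>P_matrix N\<close> by (intro P_matrix_add_diagonal)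
  moreover have "\<alpha> \<noteq> {}"
    using \<open>u \<noteq> 0\<close> by (auto simp: \<alpha>_def vec_eq_iff)
  ultimately have "det ?K \<noteq> 0"
    unfolding det_identity_rows P_matrix_def by (metis less_irrefl)
  \<comment> \<open>Rows in \<open>\<alpha>\<close> vanish by the choice of \<open>l\<close>; the
    identity rows return entries of \<open>u\<close> outside its support.\<close>
  moreover have "(?K *v u) $ a = 0" for a
  proof (cases "a \<in> \<alpha>")
    case True
    then have "(?K *v u) $ a = (\<Sum>b\<in>UNIV. N $ a $ b * u $ b + (if a = b then l a * u $ a else 0))"
      unfolding matrix_vector_mult_def L_def
      by (auto simp: distrib_right intro!: sum.cong)
    also have "\<dots> = (N *v u) $ a + l a * u $ a"
      by (simp add: sum.distrib matrix_vector_mult_def)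
    also have "\<dots> = 0"
      using True by (simp add: l_def \<alpha>_def)
    finally show ?thesis .
  next
    case False
    then have "(?K *v u) $ a = (mat 1 *v u) $ a"
      by (simp add: matrix_vector_mult_def)
    with False show ?thesis by (simp add: \<alpha>_def)
  qed
  then have "?K *v u = 0" by (simp add: vec_eq_iff)
  ultimately show False
    using \<open>u \<noteq> 0\<close> det_nz_iff_inj[OF matrix_vector_mul_linear, of ?K]
    by (simp add: linear_injective_0[OF matrix_vector_mul_linear] del: vec_lambda_beta)
qed

lemma matrix_inv_inverse:
  assumes "invertible A"
  shows "A ** matrix_inv A = mat 1" and "matrix_inv A ** A = mat 1"
  using someI_ex[OF assms[unfolded invertible_def]] by (simp_all add: matrix_inv_def)

section \<open>Bijectivity of the piecewise linear map\<close>

lemma proj_orthant_diff: "proj_orthant x - proj_orthant (- x) = x"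
  by (auto simp: vec_eq_iff proj_orthant_nth)

text \<open>If two points have the same image, \<open>D\<close> sends the difference of their
  negative parts to the difference of their positive parts. Sign reversal makes the first difference
  zero, hence also the second.\<close>

lemma inj_pl_map:
  assumes "P_matrix D"
  shows "inj (pl_map D)"
proof (rule injI)
  fix x y assume "pl_map D x = pl_map D y"
  then have Du: "D *v (proj_orthant (- x) - proj_orthant (- y)) = proj_orthant x - proj_orthant y"
    by (simp add: pl_map_eq matrix_vector_mult_diff_distrib algebra_simps)
  \<comment> \<open>Positive and negative parts are complementary, so only the mixed products, with a minus sign, survive.\<close>
  have "(proj_orthant (- x) - proj_orthant (- y)) $ i * (proj_orthant x - proj_orthant y) $ i \<le> 0" for i
    by (auto simp: proj_orthant_nth max_def mult_le_0_iff)
  then have "proj_orthant (- x) - proj_orthant (- y) = 0"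
    by (intro P_matrix_sign_reversal[OF assms]) (simp only: Du)
  moreover from this Du have "proj_orthant x - proj_orthant y = 0"
    by simp
  ultimately show "x = y"
    by (metis proj_orthant_diff right_minus_eq)
qed

lemma continuous_on_pl_map: "continuous_on S (pl_map N)"
proof -
  have *: "pl_map N =
      (\<lambda>x. (\<chi> i. max (x $ i) 0) - N *v (\<chi> i. max (- (x $ i)) 0))"
    by (auto simp: pl_map_eq fun_eq_iff vec_eq_iff proj_orthant_nth matrix_vector_mult_def)
  show ?thesis
    unfolding * by (intro continuous_intros matrix_vector_mult_linear_continuous_on
        continuous_on_compose2[OF matrix_vector_mult_linear_continuous_on[of UNIV N]]) auto
qed

lemma pl_map_zero [simp]: "pl_map N 0 = 0"
  by (simp add: pl_map_eq vec_eq_iff proj_orthant_nth matrix_vector_mult_def)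

lemma pl_map_scaleR:
  assumes "0 \<le> c"
  shows "pl_map N (c *\<^sub>R x) = c *\<^sub>R pl_map N x"
proof -
  have "proj_orthant (c *\<^sub>R y) = c *\<^sub>R proj_orthant y" for y :: "real ^ 'a"
    using assms by (auto simp: vec_eq_iff proj_orthant_nth max_def mult_le_0_iff zero_le_mult_iff)
  from this[of x] this[of "- x"] show ?thesis
    by (simp add: pl_map_eq algebra_simps matrix_vector_mult_scaleR)
qed

text \<open>The constant is the minimum of \<open>norm (pl_map N x)\<close> over the unit sphere. It
  is positive because only 0 is mapped to 0, and positive homogeneity extends the bound to all
  \<open>x\<close>.\<close>

lemma pl_map_coercive:
  fixes N :: "real ^ 'm ^ 'm"
  assumes "inj (pl_map N)"
  obtains c where "0 < c" and "\<And>x. c * norm x \<le> norm (pl_map N x)"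
proof -
  have "compact (sphere 0 1 :: (real ^ 'm) set)" "(sphere 0 1 :: (real ^ 'm) set) \<noteq> {}"
    by simp_all
  moreover have "continuous_on (sphere 0 1) (\<lambda>x. norm (pl_map N x))"
    by (intro continuous_intros continuous_on_pl_map)
  ultimately obtain z where z: "z \<in> sphere 0 1"
    and min: "\<And>y. y \<in> sphere 0 1 \<Longrightarrow> norm (pl_map N z) \<le> norm (pl_map N y)"
    using continuous_attains_inf by metis
  show ?thesis
  proof
    have "z \<noteq> 0" using z by auto
    then have "pl_map N z \<noteq> pl_map N 0" using assms by (meson injD)
    then show "0 < norm (pl_map N z)" by simp
  next
    fix x
    show "norm (pl_map N z) * norm x \<le> norm (pl_map N x)"
    proof (cases "x = 0")
      case False
      have "norm (pl_map N z) \<le> norm (pl_map N ((1 / norm x) *\<^sub>R x))"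
        using False by (intro min) simp
      also have "\<dots> = norm (pl_map N x) / norm x"
        by (subst pl_map_scaleR) auto
      finally show ?thesis using False by (simp add: field_simps)
    qed simp
  qed
qed

lemma bij_pl_map:
  fixes D :: "real ^ 'm ^ 'm"
  assumes "P_matrix D"
  shows "bij (pl_map D)"
proof -
  have inj: "inj (pl_map D)" by (rule inj_pl_map[OF assms])
  then obtain c where c: "0 < c" and coercive: "\<And>x. c * norm x \<le> norm (pl_map D x)"
    using pl_map_coercive by blast
  have "open (range (pl_map D))"
    by (intro invariance_of_domain continuous_on_pl_map open_UNIV inj)
  moreover have "closed (range (pl_map D))"
  proof (subst closure_subset_eq[symmetric], rule subsetI)
    fix y assume y: "y \<in> closure (range (pl_map D))"
    \<comment> \<open>By coercivity this ball contains every preimage of a point within distance 1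
      of \<open>y\<close>, so near \<open>y\<close> the range lies in a compact set.\<close>
    let ?K = "pl_map D ` cball 0 ((norm y + 1) / c)"
    have "ball y 1 \<inter> range (pl_map D) \<subseteq> ?K"
    proof
      fix v assume "v \<in> ball y 1 \<inter> range (pl_map D)"
      then obtain x where x: "v = pl_map D x" "dist y v < 1" by auto
      have "norm v \<le> norm y + 1"
        using norm_triangle_ineq2[of v y] x(2) by (simp add: dist_norm norm_minus_commute)
      then have "c * norm x \<le> norm y + 1"
        using coercive[of x] x(1) by simp
      then show "v \<in> ?K"
        using x(1) c by (auto simp: field_simps)
    qed
    moreover have "closed ?K"
      by (intro compact_imp_closed compact_continuous_image continuous_on_pl_map compact_cball)
    ultimately have "closure (ball y 1 \<inter> range (pl_map D)) \<subseteq> ?K"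
      by (rule closure_minimal)
    moreover have "y \<in> closure (ball y 1 \<inter> range (pl_map D))"
      using open_Int_closure_subset[of "ball y 1" "range (pl_map D)"] y by auto
    ultimately show "y \<in> range (pl_map D)" by auto
  qed
  \<comment> \<open>The space is connected, so a nonempty set that is both open and closed is
    everything.\<close>
  ultimately have "range (pl_map D) = UNIV"
    by (metis clopen UNIV_not_empty image_is_empty)
  with inj show ?thesis by (simp add: bij_def)
qed

section \<open>Correspondence between equilibria and solutions\<close>

theorem theorem4p10:
  fixes A :: "real ^ 'n ^ 'n" and B :: "real ^ 'm ^ 'n" and C :: "real ^ 'n ^ 'm"
    and D :: "real ^ 'm ^ 'm" and E1 :: "real ^ 'l ^ 'n" and E2 :: "real ^ 'l ^ 'm"
    and r s :: "real ^ 'l"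
  assumes "P_matrix D" and "invertible A"
  shows "(\<forall>\<xi>. lcs_F A B C D E1 E2 \<xi> r s = 0 \<longrightarrow>
              pl_map (lcs_M A B C D) (lcs_X C D E2 \<xi> s) = lcs_qbar A C E1 E2 r s) \<and>
         (\<forall>x. pl_map (lcs_M A B C D) x = lcs_qbar A C E1 E2 r s \<longrightarrow>
              lcs_F A B C D E1 E2 (lcs_Xi A B E1 x r) r s = 0)"
proof (intro conjI allI impI)
  let ?f = "pl_map D" and ?Ai = "matrix_inv A"
  have bij: "bij ?f" by (rule bij_pl_map[OF assms(1)])
  have inv: "?Ai *v (A *v v) = v" "A *v (?Ai *v v) = v" for v
    using assms(2) by (simp_all add: matrix_vector_mul_assoc matrix_inv_inverse)
  \<comment> \<open>The matrix enters \<open>pl_map\<close> only through its product with the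
    negative part, so passing from \<open>D\<close> to \<open>lcs_M A B C D\<close> adds a single
    term.\<close>
  have f_M: "pl_map (lcs_M A B C D) x = ?f x + C *v (?Ai *v (B *v proj_orthant (- x)))" for x
    by (simp add: pl_map_eq lcs_M_def matrix_vector_mult_diff_rdistrib
        matrix_vector_mul_assoc matrix_mul_assoc)
  have qbar: "lcs_qbar A C E1 E2 r s = E2 *v s - C *v (?Ai *v (E1 *v r))"
    by (simp add: lcs_qbar_def matrix_vector_mul_assoc matrix_mul_assoc)
  {
    fix \<xi>
    assume F0: "lcs_F A B C D E1 E2 \<xi> r s = 0"
    define x where "x = lcs_X C D E2 \<xi> s"
    \<comment> \<open>Surjectivity makes \<open>inv ?f\<close> a right inverse.\<close>
    have fx: "?f x = C *v \<xi> + E2 *v s"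
      using bij by (simp add: x_def lcs_X_def bij_is_surj surj_f_inv_f)
    have "A *v \<xi> = - (B *v proj_orthant (- x) + E1 *v r)"
      using F0 unfolding eq_neg_iff_add_eq_0 by (simp add: lcs_F_def x_def lcs_X_def add.assoc)
    then have "\<xi> = ?Ai *v (- (B *v proj_orthant (- x) + E1 *v r))"
      using inv(1)[of \<xi>] by simp
    then have "C *v \<xi> = - (C *v (?Ai *v (B *v proj_orthant (- x))) + C *v (?Ai *v (E1 *v r)))"
      by (simp add: linear_neg[OF matrix_vector_mul_linear] matrix_vector_right_distrib
          matrix_vector_mult_diff_distrib)
    then show "pl_map (lcs_M A B C D) (lcs_X C D E2 \<xi> s) = lcs_qbar A C E1 E2 r s"
      by (simp add: f_M qbar fx flip: x_def)
  next
    fix x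
    assume sol: "pl_map (lcs_M A B C D) x = lcs_qbar A C E1 E2 r s"
    define \<xi> where "\<xi> = lcs_Xi A B E1 x r"
    have "C *v \<xi> = - (C *v (?Ai *v (B *v proj_orthant (- x))) + C *v (?Ai *v (E1 *v r)))"
      by (simp add: \<xi>_def lcs_Xi_def linear_neg[OF matrix_vector_mul_linear]
          matrix_vector_right_distrib matrix_vector_mult_diff_distrib)
    moreover have "?f x = E2 *v s - C *v (?Ai *v (E1 *v r)) - C *v (?Ai *v (B *v proj_orthant (- x)))"
      using sol unfolding f_M qbar by (simp only: eq_diff_eq)
    ultimately have "C *v \<xi> + E2 *v s = ?f x"
      by (simp only:) simp
    \<comment> \<open>Injectivity recovers the given \<open>x\<close>, so the projection inside
      \<open>lcs_F\<close> is that of \<open>- x\<close>, and its terms cancel against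
      \<open>A *v \<xi>\<close>.\<close>
    then have "inv ?f (C *v \<xi> + E2 *v s) = x"
      using bij by (simp add: bij_is_inj)
    moreover have "A *v \<xi> = - (B *v proj_orthant (- x) + E1 *v r)"
      by (simp add: \<xi>_def lcs_Xi_def linear_neg[OF matrix_vector_mul_linear] inv(2))
    ultimately show "lcs_F A B C D E1 E2 (lcs_Xi A B E1 x r) r s = 0"
      by (simp add: lcs_F_def flip: \<xi>_def)
  }
qed

end
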